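(* (i) Let $N\ge 1$ be an integer. If $u$ is a measurable (a.e. finite) function on $\Lambda$, its generalized $N$-mean $U:=G_{1,N}(u)$ is essentially bounded above (respectively below) if and only if $u$ is essentially bounded above (respectively below). Furthermore, $\operatorname{ess\,sup}U=\operatorname{ess\,sup}u$ and $\operatorname{ess\,inf}U=\operatorname{ess\,inf}u$. In particular, $u\in L^\infty(\Lambda;dx)$ if and only if $U\in L^\infty(\Lambda^N;d^Nx)$ and, if so, $\|U\|_{\Lambda^N,\infty}=\|u\|_{\Lambda,\infty}$. (ii) Let $1\le m\le N$ be integers. If $u\in L^\infty(\Lambda^m;d^mx)$, then $G_{m,N}(u)\in L^\infty(\Lambda^N;d^Nx)$ and $\|G_{m,N}(u)\|_{\Lambda^N,\infty}\le\|u\|_{\Lambda^m,\infty}$. Conversely, if $U\in L^\infty(\Lambda^N;d^Nx)$ is a generalized $N$-mean of order $m$, then $K_{m,N}(U)\in L^\infty(\Lambda^m;d^mx)$ and there is a constant $C(m,N)$ independent of $U$ such that $\|K_{m,N}(U)\|_{\Lambda^m,\infty}\le C(m,N)\|U\|_{\Lambda^N,\infty}$.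
   Context: $\Lambda$ is a set with a $\sigma$-finite complete measure $dx$, of strictly positive total measure. For $k\ge 1$, $d^kx$ is the completion of the product measure $dx^{\otimes k}$ on $\Lambda^k$; "a.e.", "null set" and "measurable" on $\Lambda^k$ refer to $d^kx$. $\|\cdot\|_{\Lambda^k,\infty}$ is the norm of $L^\infty(\Lambda^k;d^kx)$. Functions are (extended) real-valued and defined a.e.; "a.e. finite" means finite-valued off a null set. No symmetry of the functions is assumed. For integers $1\le m\le N$ and an a.e. finite function $u$ on $\Lambda^m$, the generalized $N$-mean of order $m$ with kernel $u$ is the a.e. defined function on $\Lambda^N$ $$G_{m,N}(u)(x_1,\dots,x_N):=\binom{N}{m}^{-1}\sum_{1\le i_1<\cdots<i_m\le N}u(x_{i_1},\dots,x_{i_m}),$$ equality being understood a.e. on $\Lambda^N$. The kernel of a generalized $N$-mean of order $m$ is unique up to modification on a null set; $K_{m,N}$ denotes the inverse of $G_{m,N}$, i.e. $K_{m,N}(U)=u$ when $U=G_{m,N}(u)$. *)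

theory Defs
  imports "HOL-Probability.Essential_Supremum"
begin

text \<open>
  Points of \<open>\<Lambda>\<^sup>k\<close> are functions \<open>x \<in> {..<k} \<rightarrow>\<^sub>E space M\<close>, so coordinates are numbered from 0.
  Functions defined almost everywhere are represented by total \<open>ereal\<close>-valued functions, used
  only through notions that are invariant under modification on null sets.
\<close>

definition pow_measure :: "'a measure \<Rightarrow> nat \<Rightarrow> (nat \<Rightarrow> 'a) measure" where
  "pow_measure M k = completion (PiM {..<k} (\<lambda>_. M))"

definition ae_finite :: "'b measure \<Rightarrow> ('b \<Rightarrow> ereal) \<Rightarrow> bool" where
  "ae_finite M f \<longleftrightarrow> (AE x in M. \<bar>f x\<bar> \<noteq> \<infinity>)"

text \<open>
  The summation index \<open>i\<close> runs through the tuples \<open>i\<^sub>0 < \<dots> < i\<^bsub>m-1\<^esub>\<close> in \<open>{..<N}\<close>.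
  If \<open>u\<close> is finite almost everywhere, undetermined sums \<open>\<infinity> - \<infinity>\<close> occur on a null set only.
\<close>

definition gen_mean :: "nat \<Rightarrow> nat \<Rightarrow> ((nat \<Rightarrow> 'a) \<Rightarrow> ereal) \<Rightarrow> (nat \<Rightarrow> 'a) \<Rightarrow> ereal" where
  "gen_mean m N u x =
     (\<Sum>i \<in> {i \<in> {..<m} \<rightarrow>\<^sub>E {..<N}. strict_mono_on {..<m} i}. u (\<lambda>k\<in>{..<m}. x (i k)))
       / ereal (real (N choose m))"

text \<open>
  The inverse \<open>K\<^bsub>m,N\<^esub>\<close> of \<open>G\<^bsub>m,N\<^esub>\<close>: a kernel is only determined up to a null set, and
  \<open>mean_kernel M m N U\<close> is the set of all its representatives. No measurability of the
  kernel is required.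
\<close>

definition mean_kernel ::
  "'a measure \<Rightarrow> nat \<Rightarrow> nat \<Rightarrow> ((nat \<Rightarrow> 'a) \<Rightarrow> ereal) \<Rightarrow> ((nat \<Rightarrow> 'a) \<Rightarrow> ereal) set" where
  "mean_kernel M m N U =
     {u. ae_finite (pow_measure M m) u \<and> (AE x in pow_measure M N. U x = gen_mean m N u x)}"

definition is_gen_mean :: "'a measure \<Rightarrow> nat \<Rightarrow> nat \<Rightarrow> ((nat \<Rightarrow> 'a) \<Rightarrow> ereal) \<Rightarrow> bool" where
  "is_gen_mean M m N U \<longleftrightarrow> mean_kernel M m N U \<noteq> {}"

definition ess_bdd_above :: "'b measure \<Rightarrow> ('b \<Rightarrow> ereal) \<Rightarrow> bool" where
  "ess_bdd_above M f \<longleftrightarrow> (\<exists>c::real. AE x in M. f x \<le> ereal c)"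

definition ess_bdd_below :: "'b measure \<Rightarrow> ('b \<Rightarrow> ereal) \<Rightarrow> bool" where
  "ess_bdd_below M f \<longleftrightarrow> (\<exists>c::real. AE x in M. ereal c \<le> f x)"

definition essinf :: "'b measure \<Rightarrow> ('b \<Rightarrow> ereal) \<Rightarrow> ereal" where
  "essinf M f = Sup {z. AE x in M. z \<le> f x}"

definition Linf_norm :: "'b measure \<Rightarrow> ('b \<Rightarrow> ereal) \<Rightarrow> ereal" where
  "Linf_norm M f = esssup M (\<lambda>x. \<bar>f x\<bar>)"

definition Linf :: "'b measure \<Rightarrow> ('b \<Rightarrow> ereal) set" where
  "Linf M = {f \<in> borel_measurable M. Linf_norm M f < \<infinity>}"

end

theory Submission
  imports Defs
begin

text \<open>
  Part (i) reduces to: \<open>U \<le> c\<close> a.e. iff \<open>u \<le> c\<close> a.e.; if \<open>u > c\<close> on a set \<open>A\<close> of positive measure,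
  then \<open>U > c\<close> on \<open>A\<^sup>N\<close>, which has positive measure as well.

  For the converse in (ii), evaluate at a generic point \<open>z\<close> of \<open>\<Lambda>\<^bsup>N+m\<^esup>\<close>. The values of \<open>u\<close> at the
  subtuples of length \<open>m\<close> of \<open>z\<close> are a function on the \<open>m\<close>-subsets of the \<open>N + m\<close> indices, and \<open>U\<close> at
  the subtuples of length \<open>N\<close> gives the sums of that function over the \<open>m\<close>-subsets of \<open>N\<close>-subsets.
  Since there are enough indices, these sums determine the function linearly, so
  \<open>u(z\<^sub>0, \<dots>, z\<^bsub>m-1\<^esub>)\<close> is a fixed linear combination of values of \<open>U\<close>. This gives the bound, and
  freezing the last \<open>N\<close> coordinates at a generic value shows that \<open>u\<close> is measurable.
\<close>

section \<open>Inverting sums over subsets\<close>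

definition subsets_sum :: "nat \<Rightarrow> ('i set \<Rightarrow> real) \<Rightarrow> 'i set \<Rightarrow> real" where
  "subsets_sum m f J = (\<Sum>I | I \<subseteq> J \<and> card I = m. f I)"

text \<open>The coefficients \<open>c\<close> are quantified before \<open>f\<close>:
  \<open>\<phi>\<close> lies in the linear span of the functionals
  \<open>\<lambda>f. subsets_sum m f J\<close>, so one identity can later be applied to a different
  \<open>f\<close> at every point. The closure rules that follow are those of a linear span, in a
  form fit for \<open>intro\<close>.\<close>

definition sums_representable ::
  "'i set \<Rightarrow> nat \<Rightarrow> nat \<Rightarrow> (('i set \<Rightarrow> real) \<Rightarrow> real) \<Rightarrow> bool" where
  "sums_representable X m N \<phi> \<longleftrightarrow>
     (\<exists>c. \<forall>f. \<phi> f = (\<Sum>J | J \<subseteq> X \<and> card J = N. c J * subsets_sum m f J))"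

lemma sums_representable_zero: "sums_representable X m N (\<lambda>f. 0)"
  unfolding sums_representable_def by (rule exI[of _ "\<lambda>_. 0"]) simp

lemma sums_representable_add:
  assumes "sums_representable X m N \<phi>" "sums_representable X m N \<psi>"
  shows "sums_representable X m N (\<lambda>f. \<phi> f + \<psi> f)"
proof -
  obtain c d where "\<And>f. \<phi> f = (\<Sum>J | J \<subseteq> X \<and> card J = N. c J * subsets_sum m f J)"
    and "\<And>f. \<psi> f = (\<Sum>J | J \<subseteq> X \<and> card J = N. d J * subsets_sum m f J)"
    using assms unfolding sums_representable_def by blast
  then show ?thesis
    unfolding sums_representable_def
    by (intro exI[of _ "\<lambda>J. c J + d J"]) (simp add: sum.distrib distrib_right)
qed

lemma sums_representable_cmult:
  assumes "sums_representable X m N \<phi>"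
  shows "sums_representable X m N (\<lambda>f. a * \<phi> f)"
proof -
  obtain c where "\<And>f. \<phi> f = (\<Sum>J | J \<subseteq> X \<and> card J = N. c J * subsets_sum m f J)"
    using assms unfolding sums_representable_def by blast
  then show ?thesis
    unfolding sums_representable_def
    by (intro exI[of _ "\<lambda>J. a * c J"]) (simp add: sum_distrib_left mult.assoc)
qed

lemma sums_representable_diff:
  assumes "sums_representable X m N \<phi>" "sums_representable X m N \<psi>"
  shows "sums_representable X m N (\<lambda>f. \<phi> f - \<psi> f)"
  using sums_representable_add[OF assms(1) sums_representable_cmult[OF assms(2), of "-1"]] by simp

lemma sums_representable_sum:
  assumes "\<And>s. s \<in> S \<Longrightarrow> sums_representable X m N (\<phi> s)"
  shows "sums_representable X m N (\<lambda>f. \<Sum>s\<in>S. \<phi> s f)"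
  using assms
  by (induction S rule: infinite_finite_induct)
     (auto intro: sums_representable_zero sums_representable_add)

lemma sums_representable_subsets_sum:
  assumes "finite X" "J \<subseteq> X" "card J = N"
  shows "sums_representable X m N (\<lambda>f. subsets_sum m f J)"
  unfolding sums_representable_def
proof (intro exI allI)
  fix f
  show "subsets_sum m f J =
      (\<Sum>J' | J' \<subseteq> X \<and> card J' = N. (if J' = J then 1 else 0) * subsets_sum m f J')"
    using assms by (simp add: if_distrib[of "\<lambda>x. x * _"] sum.If_cases)
qed

text \<open>Pascal's rule: the subsets counted on the left either avoid \<open>a\<close> or arise
  from an \<open>m\<close>-subset of \<open>J\<close> by adding \<open>a\<close>. Its use is that
  the first summand does not involve \<open>a\<close>, so it cancels when two choices of
  \<open>a\<close> are compared.\<close>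

lemma subsets_sum_insert:
  assumes "finite J" "a \<notin> J"
  shows "subsets_sum (Suc m) f (insert a J) =
    subsets_sum (Suc m) f J + subsets_sum m (\<lambda>K. f (insert a K)) J"
proof -
  have split: "{I. I \<subseteq> insert a J \<and> card I = Suc m} =
      {I. I \<subseteq> J \<and> card I = Suc m} \<union> insert a ` {K. K \<subseteq> J \<and> card K = m}" (is "?L = ?A \<union> ?B")
  proof (intro equalityI subsetI)
    fix I assume I: "I \<in> ?L"
    show "I \<in> ?A \<union> ?B"
    proof (cases "a \<in> I")
      case True
      then have "I = insert a (I - {a})" by auto
      moreover have "I - {a} \<subseteq> J" "card (I - {a}) = m" using I True by auto
      ultimately show ?thesis by blast
    qed (use I in auto)
  next
    fix I assume "I \<in> ?A \<union> ?B"
    then show "I \<in> ?L"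
    proof
      assume "I \<in> ?B"
      then obtain K where K: "I = insert a K" "K \<subseteq> J" "card K = m" by auto
      moreover have "finite K" "a \<notin> K" using K assms finite_subset by auto
      ultimately show ?thesis by auto
    qed auto
  qed
  have inj: "inj_on (insert a) {K. K \<subseteq> J \<and> card K = m}"
    using assms by (auto simp: inj_on_def)
  have "subsets_sum (Suc m) f (insert a J) = sum f ?A + sum f ?B"
    unfolding subsets_sum_def split using assms by (intro sum.union_disjoint) auto
  then show ?thesis
    by (simp add: subsets_sum_def sum.reindex[OF inj])
qed

text \<open>This says that inclusion matrices have full rank. For the induction on \<open>m\<close>: the difference
  \<open>f (insert a K) - f (insert b K)\<close> is a function of \<open>K\<close> whose sums over \<open>(m - 1)\<close>-subsets are
  differences of sums of \<open>f\<close>.\<close>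

lemma sums_representable_eval:
  assumes "finite X" "N + m \<le> card X" "m \<le> N" "I \<subseteq> X" "card I = m"
  shows "sums_representable X m N (\<lambda>f. f I)"
  using assms
proof (induction m arbitrary: N X I)
  case 0
  then obtain J where J: "J \<subseteq> X" "card J = N" "finite J"
    by (metis add.right_neutral obtain_subset_with_card_n)
  have "I = {}" using 0 finite_subset by fastforce
  moreover have "{I. I \<subseteq> J \<and> card I = 0} = {{}}"
    using J(3) finite_subset by fastforce
  ultimately show ?case
    using sums_representable_subsets_sum[OF 0(1) J(1,2), of 0] by (simp add: subsets_sum_def)
next
  case (Suc m)
  note fin = finite_subset[OF _ \<open>finite X\<close>]
  obtain N' where N: "N = Suc N'" "m \<le> N'" using Suc.prems(3) by (cases N) auto
  let ?R = "sums_representable X (Suc m) N"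
  have swap: "?R (\<lambda>f. f (insert a K) - f (insert b K))"
    if K: "K \<subseteq> X" "card K = m" "a \<in> X - K" "b \<in> X - K" "a \<noteq> b" for K a b
  proof -
    \<comment> \<open>The induction hypothesis is used on the points other than \<open>a\<close> and
      \<open>b\<close>, with \<open>N'\<close> for \<open>N\<close>. Its size condition survives
      exactly: \<open>N + Suc m = N' + m + 2\<close>, and two points are removed.\<close>
    let ?Y = "X - {a, b}"
    have "card ?Y = card X - 2" using K Suc.prems(1) by (simp add: card_Diff_subset)
    then have "sums_representable ?Y m N' (\<lambda>f. f K)"
      using K N Suc.prems by (intro Suc.IH) auto
    then obtain c where c: "\<And>f. f K =
        (\<Sum>J | J \<subseteq> ?Y \<and> card J = N'. c J * subsets_sum m f J)"
      unfolding sums_representable_def by blast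
    \<comment> \<open>The coefficients \<open>c\<close> are applied to the function sending
      \<open>K\<close> to \<open>f (insert a K) - f (insert b K)\<close>. By
      \<open>subsets_sum_insert\<close>, its sums of order \<open>m\<close> over \<open>J\<close>
      are differences of sums of order \<open>Suc m\<close>, as the part inside \<open>J\<close>
      cancels.\<close>
    have eq: "f (insert a K) - f (insert b K) =
        (\<Sum>J | J \<subseteq> ?Y \<and> card J = N'.
          c J * (subsets_sum (Suc m) f (insert a J) - subsets_sum (Suc m) f (insert b J)))" for f
    proof (subst c[of "\<lambda>K. f (insert a K) - f (insert b K)"], intro sum.cong refl)
      fix J assume "J \<in> {J. J \<subseteq> ?Y \<and> card J = N'}"
      then have "finite J" "a \<notin> J" "b \<notin> J" using fin by auto
      then show "c J * subsets_sum m (\<lambda>K. f (insert a K) - f (insert b K)) J =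
          c J * (subsets_sum (Suc m) f (insert a J) - subsets_sum (Suc m) f (insert b J))"
        by (simp add: subsets_sum_insert) (simp add: subsets_sum_def sum_subtractf)
    qed
    have J: "insert a J \<subseteq> X" "insert b J \<subseteq> X" "card (insert a J) = N" "card (insert b J) = N"
      if "J \<subseteq> ?Y" "card J = N'" for J
    proof -
      have "finite J" "a \<notin> J" "b \<notin> J" using that fin by auto
      then show "card (insert a J) = N" "card (insert b J) = N" using that N by auto
    qed (use that K in auto)
    show ?thesis
      unfolding eq
      by (intro sums_representable_sum sums_representable_cmult sums_representable_diff
          sums_representable_subsets_sum Suc.prems(1)) (use J in auto)
  qed
  \<comment> \<open>Telescoping: \<open>I1\<close> is carried to \<open>I2\<close> by exchanging one
    element at a time, and each exchange is an instance of \<open>swap\<close>.\<close>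
  have diff: "?R (\<lambda>f. f I1 - f I2)"
    if "I1 \<subseteq> X" "card I1 = Suc m" "I2 \<subseteq> X" "card I2 = Suc m" for I1 I2
    using that
  proof (induction "card (I1 - I2)" arbitrary: I1 rule: less_induct)
    case less
    note f = fin[OF less.prems(1)] fin[OF less.prems(3)]
    show ?case
    proof (cases "I1 = I2")
      case True
      then show ?thesis by (simp add: sums_representable_zero)
    next
      case False
      then obtain a where a: "a \<in> I1" "a \<notin> I2"
        using less.prems f card_subset_eq[of I2 I1] by auto
      obtain b where b: "b \<in> I2" "b \<notin> I1"
        using less.prems f False card_subset_eq[of I1 I2] by auto
      let ?K = "I1 - {a}"
      have K: "insert a ?K = I1" "card ?K = m" using a f less.prems by auto
      have R1: "?R (\<lambda>f. f (insert a ?K) - f (insert b ?K))"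
        using a b less.prems K by (intro swap) auto
      have "insert b ?K - I2 \<subset> I1 - I2" using a b by auto
      then have "card (insert b ?K - I2) < card (I1 - I2)"
        using f by (intro psubset_card_mono) auto
      then have "?R (\<lambda>f. f (insert b ?K) - f I2)"
        using a b f K less.prems by (intro less.hyps) auto
      from sums_representable_add[OF R1 this] show ?thesis using a by (simp add: insert_absorb)
    qed
  qed
  obtain J where J: "J \<subseteq> X" "card J = N" "finite J"
    using Suc.prems(2) by (metis add_leD1 obtain_subset_with_card_n)
  \<comment> \<open>With all differences available, a single sum fixes the remaining constant: in
    the sum over one \<open>J\<close>, each of the \<open>N choose Suc m\<close> terms is replaced
    by \<open>f I\<close> minus a difference.\<close>
  have "real (N choose Suc m) * f I =
      subsets_sum (Suc m) f J + (\<Sum>I' | I' \<subseteq> J \<and> card I' = Suc m. f I - f I')" for f :: "_ \<Rightarrow> real"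
    using n_subsets[OF J(3), of "Suc m"] by (simp add: sum_subtractf subsets_sum_def J)
  moreover have "real (N choose Suc m) \<noteq> 0" using Suc.prems(3) by simp
  ultimately have eq: "f I = inverse (real (N choose Suc m)) *
      (subsets_sum (Suc m) f J + (\<Sum>I' | I' \<subseteq> J \<and> card I' = Suc m. f I - f I'))" for f :: "_ \<Rightarrow> real"
    by (metis (no_types) mult.assoc left_inverse mult_1)
  have "?R (\<lambda>f. inverse (real (N choose Suc m)) *
      (subsets_sum (Suc m) f J + (\<Sum>I' | I' \<subseteq> J \<and> card I' = Suc m. f I - f I')))"
    using J Suc.prems
    by (intro sums_representable_cmult sums_representable_add sums_representable_sum
        sums_representable_subsets_sum diff) auto
  then show ?case by (simp flip: eq)
qed

section \<open>Increasing index tuples as enumerations of subsets\<close>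

definition incr_maps :: "nat \<Rightarrow> nat \<Rightarrow> (nat \<Rightarrow> nat) set" where
  "incr_maps m N = {i \<in> {..<m} \<rightarrow>\<^sub>E {..<N}. strict_mono_on {..<m} i}"

lemma finite_incr_maps: "finite (incr_maps m N)"
  unfolding incr_maps_def by (rule finite_subset[of _ "{..<m} \<rightarrow>\<^sub>E {..<N}"]) (auto intro: finite_PiE)

lemma incr_maps_inj_on: "i \<in> incr_maps m N \<Longrightarrow> inj_on i {..<m}"
  unfolding incr_maps_def by (auto intro: strict_mono_on_imp_inj_on)

lemma incr_maps_image: "i \<in> incr_maps m N \<Longrightarrow> i ` {..<m} \<subseteq> {..<N}"
  unfolding incr_maps_def by auto

lemma incr_maps_comp:
  assumes "i \<in> incr_maps m N" "j \<in> incr_maps N L"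
  shows "(\<lambda>k\<in>{..<m}. j (i k)) \<in> incr_maps m L"
  using assms unfolding incr_maps_def
  by (auto simp: strict_mono_on_def PiE_iff Pi_iff)

lemma incr_maps_id: "m \<le> N \<Longrightarrow> (\<lambda>k\<in>{..<m}. k) \<in> incr_maps m N"
  unfolding incr_maps_def by (auto simp: strict_mono_on_def)

text \<open>A finite set of numbers has exactly one increasing enumeration. Injectivity compares
  sorted distinct lists with the same elements, and extensionality of the maps then gives equality
  everywhere.\<close>

lemma bij_betw_incr_maps_subsets:
  "bij_betw (\<lambda>i. i ` {..<m}) (incr_maps m N) {I. I \<subseteq> {..<N} \<and> card I = m}"
proof (rule bij_betw_imageI)
  show "inj_on (\<lambda>i. i ` {..<m}) (incr_maps m N)"
  proof (rule inj_onI)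
    fix i j assume ij: "i \<in> incr_maps m N" "j \<in> incr_maps m N" "i ` {..<m} = j ` {..<m}"
    have "sorted (map i [0..<m])" "distinct (map i [0..<m])" if "i \<in> incr_maps m N" for i
      using that incr_maps_inj_on[OF that]
      by (auto simp: incr_maps_def strict_mono_on_def sorted_iff_nth_mono_less distinct_map
          atLeast0LessThan less_imp_le)
    then have "map i [0..<m] = map j [0..<m]"
      using ij by (intro sorted_distinct_set_unique) (auto simp: atLeast0LessThan)
    then show "i = j"
      using ij by (intro PiE_ext[of _ "{..<m}" "\<lambda>_. {..<N}"]) (auto simp: incr_maps_def)
  qed
  show "(\<lambda>i. i ` {..<m}) ` incr_maps m N = {I. I \<subseteq> {..<N} \<and> card I = m}"
  proof (intro equalityI subsetI)
    fix I assume I: "I \<in> {I. I \<subseteq> {..<N} \<and> card I = m}"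
    then have "finite I" using finite_subset by blast
    then obtain h where h: "bij_betw h {..<card I} I" "strict_mono_on {..<card I} h"
      by (rule ex_bij_betw_strict_mono_card)
    then have im: "h ` {..<m} = I" using I by (simp add: bij_betw_def)
    then have "restrict h {..<m} \<in> incr_maps m N"
      using h I by (auto simp: incr_maps_def strict_mono_on_def)
    moreover have "restrict h {..<m} ` {..<m} = I" using im by auto
    ultimately show "I \<in> (\<lambda>i. i ` {..<m}) ` incr_maps m N" by (metis imageI)
  qed (auto simp: card_image incr_maps_inj_on dest: incr_maps_image)
qed

lemma card_incr_maps: "card (incr_maps m N) = N choose m"
  using bij_betw_same_card[OF bij_betw_incr_maps_subsets[of m N]] by (simp add: n_subsets)

text \<open>This is \<open>sums_representable_eval\<close> for the ground set
  \<open>{..<N + m}\<close> and its subset \<open>{..<m}\<close>, rewritten in terms of tuples. The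
  inner sum is, up to normalization, a mean evaluated at the subtuple chosen by
  \<open>j\<close>.\<close>

lemma incr_maps_sum_inversion:
  assumes "m \<le> N"
  obtains c :: "(nat \<Rightarrow> nat) \<Rightarrow> real" where
    "\<And>g :: (nat \<Rightarrow> nat) \<Rightarrow> real. g (\<lambda>k\<in>{..<m}. k) =
       (\<Sum>j\<in>incr_maps N (N + m). c j * (\<Sum>i\<in>incr_maps m N. g (\<lambda>k\<in>{..<m}. j (i k))))"
proof -
  let ?L = "N + m"
  have "sums_representable {..<?L} m N (\<lambda>f. f {..<m})"
    using assms by (intro sums_representable_eval) auto
  then obtain d where d: "\<And>f. f {..<m} =
      (\<Sum>J | J \<subseteq> {..<?L} \<and> card J = N. d J * subsets_sum m f J)"
    unfolding sums_representable_def by blast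
  have "g (\<lambda>k\<in>{..<m}. k) = (\<Sum>j\<in>incr_maps N ?L.
      d (j ` {..<N}) * (\<Sum>i\<in>incr_maps m N. g (\<lambda>k\<in>{..<m}. j (i k))))"
    for g :: "(nat \<Rightarrow> nat) \<Rightarrow> real"
  proof -
    \<comment> \<open>\<open>g\<close> is a function of tuples while \<open>d\<close> acts on
      functions of sets, so \<open>g\<close> is transported along the inverse of the enumeration
      bijection.\<close>
    define f where "f I = g (the_inv_into (incr_maps m ?L) (\<lambda>i. i ` {..<m}) I)" for I
    have f: "f (i ` {..<m}) = g i" if "i \<in> incr_maps m ?L" for i
      unfolding f_def using that bij_betw_incr_maps_subsets[of m ?L]
      by (subst the_inv_into_f_f) (auto simp: bij_betw_def)
    have F: "subsets_sum m f (j ` {..<N}) = (\<Sum>i\<in>incr_maps m N. g (\<lambda>k\<in>{..<m}. j (i k)))"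
      if j: "j \<in> incr_maps N ?L" for j
    proof -
      have inj: "inj_on j {..<N}" by (rule incr_maps_inj_on[OF j])
      have "bij_betw ((`) j) {I. I \<subseteq> {..<N} \<and> card I = m} {I. I \<subseteq> j ` {..<N} \<and> card I = m}"
      proof (rule bij_betw_imageI)
        show "inj_on ((`) j) {I. I \<subseteq> {..<N} \<and> card I = m}"
          using inj_on_image_eq_iff[OF inj] by (auto simp: inj_on_def)
        show "(`) j ` {I. I \<subseteq> {..<N} \<and> card I = m} = {I. I \<subseteq> j ` {..<N} \<and> card I = m}"
          using inj
          by (auto simp: card_image inj_on_subset subset_image_iff intro!: image_eqI)
      qed
      from bij_betw_trans[OF bij_betw_incr_maps_subsets this]
      have "subsets_sum m f (j ` {..<N}) = (\<Sum>i\<in>incr_maps m N. f (j ` i ` {..<m}))"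
        unfolding subsets_sum_def by (subst sum.reindex_bij_betw[symmetric]) (auto simp: o_def)
      also have "\<dots> = (\<Sum>i\<in>incr_maps m N. g (\<lambda>k\<in>{..<m}. j (i k)))"
      proof (intro sum.cong refl)
        fix i assume "i \<in> incr_maps m N"
        from f[OF incr_maps_comp[OF this j]]
        show "f (j ` i ` {..<m}) = g (\<lambda>k\<in>{..<m}. j (i k))"
          by (simp add: image_image cong: image_cong_simp)
      qed
      finally show ?thesis .
    qed
    have "g (\<lambda>k\<in>{..<m}. k) = f {..<m}"
      using f[OF incr_maps_id[of m ?L]] by (simp cong: image_cong_simp)
    also have "\<dots> = (\<Sum>j\<in>incr_maps N ?L. d (j ` {..<N}) * subsets_sum m f (j ` {..<N}))"
      unfolding d[of f] by (rule sum.reindex_bij_betw[OF bij_betw_incr_maps_subsets, symmetric])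
    finally show ?thesis by (simp add: F)
  qed
  then show ?thesis by (rule that)
qed

section \<open>Null sets of product measures\<close>

text \<open>Preimages under \<open>f\<close> and \<open>g\<close> differ by a subset of a null set,
  which completeness makes measurable. It serves to derive measurability of a kernel, which
  \<open>mean_kernel\<close> does not demand.\<close>

lemma (in complete_measure) borel_measurable_AE_eq:
  assumes g: "g \<in> borel_measurable M" and ae: "AE x in M. f x = g x"
  shows "f \<in> borel_measurable M"
proof (rule measurableI)
  fix A :: "'b set" assume "A \<in> sets borel"
  then have "g -` A \<inter> space M \<in> sets M" using g by (rule measurable_sets[rotated])
  with _ show "f -` A \<inter> space M \<in> sets M"
    by (rule in_sets_AE) (use ae in auto)
qed simp

context sigma_finite_measure
begin

sublocale pow: product_sigma_finite "\<lambda>_. M"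
  by standard

text \<open>When the coordinates are split into \<open>I\<close> and \<open>J - I\<close>, the
  exceptional set becomes a cylinder over a null set \<open>A\<close>. Its measure is a product with
  a factor 0, hence 0 even if the other factor is infinite.\<close>

lemma AE_PiM_restrict:
  assumes "finite J" "I \<subseteq> J" "AE x in PiM I (\<lambda>_. M). P x"
  shows "AE z in PiM J (\<lambda>_. M). P (restrict z I)"
proof -
  have fin: "finite I" "finite (J - I)" using assms finite_subset by auto
  interpret K: sigma_finite_measure "PiM (J - I) (\<lambda>_. M)" by (rule pow.sigma_finite) fact
  obtain A where A: "A \<in> null_sets (PiM I (\<lambda>_. M))" "{x \<in> space (PiM I (\<lambda>_. M)). \<not> P x} \<subseteq> A"
    using assms(3) unfolding eventually_ae_filter by auto
  let ?PQ = "PiM I (\<lambda>_. M) \<Otimes>\<^sub>M PiM (J - I) (\<lambda>_. M)"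
  let ?A = "(\<lambda>z. restrict z I) -` A \<inter> space (PiM J (\<lambda>_. M))"
  have meas: "(\<lambda>z. restrict z I) \<in> PiM J (\<lambda>_. M) \<rightarrow>\<^sub>M PiM I (\<lambda>_. M)"
    using assms(2) by (rule measurable_restrict_subset)
  have J: "I \<union> (J - I) = J" using assms(2) by auto
  have mm: "merge I (J - I) \<in> ?PQ \<rightarrow>\<^sub>M PiM J (\<lambda>_. M)"
    using measurable_merge[of I "J - I" "\<lambda>_. M"] unfolding J .
  have "merge I (J - I) w \<in> ?A \<longleftrightarrow> fst w \<in> A" if "w \<in> space ?PQ" for w
    using measurable_space[OF mm that] that
    by (cases w) (auto simp: space_pair_measure space_PiM PiE_iff restrict_merge extensional_restrict)
  then have eq: "merge I (J - I) -` ?A \<inter> space ?PQ = A \<times> space (PiM (J - I) (\<lambda>_. M))"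
    using sets.sets_into_space[of A "PiM I (\<lambda>_. M)"] A(1)
    by (fastforce simp: space_pair_measure)
  have distr: "distr ?PQ (PiM J (\<lambda>_. M)) (merge I (J - I)) = PiM J (\<lambda>_. M)"
    using pow.distr_merge[of I "J - I"] fin unfolding J by auto
  have sA: "?A \<in> sets (PiM J (\<lambda>_. M))" using A meas by (auto intro: measurable_sets)
  have "emeasure (PiM J (\<lambda>_. M)) ?A = emeasure ?PQ (A \<times> space (PiM (J - I) (\<lambda>_. M)))"
    by (subst distr[symmetric], subst emeasure_distr[OF mm sA]) (simp only: eq)
  also have "\<dots> = 0"
    using A by (subst K.emeasure_pair_measure_Times) (auto simp: null_sets_def)
  finally have "?A \<in> null_sets (PiM J (\<lambda>_. M))" using sA by auto
  then show ?thesis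
    by (rule AE_I') (use A(2) measurable_space[OF meas] in auto)
qed

text \<open>Renaming coordinates preserves the product measure, because it maps boxes to boxes with
  the same factors and boxes determine that measure.\<close>

lemma AE_PiM_reindex_bij:
  assumes "finite I" "bij_betw i I K" "AE x in PiM I (\<lambda>_. M). P x"
  shows "AE z in PiM K (\<lambda>_. M). P (\<lambda>k\<in>I. z (i k))"
proof -
  have K: "finite K" "i ` I = K" "inj_on i I" using assms bij_betw_finite by (auto simp: bij_betw_def)
  have m: "(\<lambda>z. \<lambda>k\<in>I. z (i k)) \<in> PiM K (\<lambda>_. M) \<rightarrow>\<^sub>M PiM I (\<lambda>_. M)"
    using K by (intro measurable_restrict measurable_component_singleton) auto
  have "distr (PiM K (\<lambda>_. M)) (PiM I (\<lambda>_. M)) (\<lambda>z. \<lambda>k\<in>I. z (i k)) = PiM I (\<lambda>_. M)"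
  proof (rule pow.PiM_eqI)
    fix A assume A: "\<And>k. k \<in> I \<Longrightarrow> A k \<in> sets M"
    let ?B = "\<lambda>k. A (the_inv_into I i k)"
    have B: "?B (i k) = A k" if "k \<in> I" for k
      using that K by (simp add: the_inv_into_f_f)
    have "(\<lambda>z. \<lambda>k\<in>I. z (i k)) -` Pi\<^sub>E I A \<inter> space (PiM K (\<lambda>_. M)) = Pi\<^sub>E K ?B"
    proof (intro equalityI subsetI)
      fix z assume "z \<in> (\<lambda>z. \<lambda>k\<in>I. z (i k)) -` Pi\<^sub>E I A \<inter> space (PiM K (\<lambda>_. M))"
      then have "\<forall>k\<in>I. z (i k) \<in> A k" and ext: "z \<in> extensional K"
        by (auto simp: space_PiM PiE_iff)
      then have "\<forall>l\<in>i ` I. z l \<in> ?B l" by (auto simp: B)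
      then show "z \<in> Pi\<^sub>E K ?B" using ext K(2) by (simp add: PiE_iff)
    next
      fix z assume "z \<in> Pi\<^sub>E K ?B"
      then have "\<forall>l\<in>i ` I. z l \<in> ?B l" and ext: "z \<in> extensional K"
        using K(2) by (auto simp: PiE_iff)
      then have z: "\<forall>k\<in>I. z (i k) \<in> A k" by (simp add: B)
      then have "\<forall>l\<in>i ` I. z l \<in> space M"
        using A[THEN sets.sets_into_space] by blast
      then show "z \<in> (\<lambda>z. \<lambda>k\<in>I. z (i k)) -` Pi\<^sub>E I A \<inter> space (PiM K (\<lambda>_. M))"
        using z ext K(2) by (simp add: space_PiM PiE_iff)
    qed
    then have "emeasure (distr (PiM K (\<lambda>_. M)) (PiM I (\<lambda>_. M)) (\<lambda>z. \<lambda>k\<in>I. z (i k))) (Pi\<^sub>E I A)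
        = emeasure (PiM K (\<lambda>_. M)) (Pi\<^sub>E K ?B)"
      using m A assms(1) by (subst emeasure_distr) (auto intro: sets_PiM_I_finite)
    also have "\<dots> = (\<Prod>k\<in>K. emeasure M (?B k))"
      using A B K by (intro pow.emeasure_PiM) auto
    also have "\<dots> = (\<Prod>k\<in>I. emeasure M (A k))"
      using B K by (subst K(2)[symmetric], subst prod.reindex) auto
    finally show "emeasure (distr (PiM K (\<lambda>_. M)) (PiM I (\<lambda>_. M)) (\<lambda>z. \<lambda>k\<in>I. z (i k))) (Pi\<^sub>E I A)
        = (\<Prod>k\<in>I. emeasure M (A k))" .
  qed (use assms in auto)
  then have "AE x in distr (PiM K (\<lambda>_. M)) (PiM I (\<lambda>_. M)) (\<lambda>z. \<lambda>k\<in>I. z (i k)). P x"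
    using assms(3) by (simp only:)
  then show ?thesis by (rule AE_distrD[OF m])
qed

text \<open>Injectivity of \<open>i\<close> is what matters: a repeated index would place the tuple
  on a diagonal, which may itself be a null set.\<close>

lemma AE_PiM_reindex:
  assumes "finite I" "finite J" "inj_on i I" "i ` I \<subseteq> J" "AE x in PiM I (\<lambda>_. M). P x"
  shows "AE z in PiM J (\<lambda>_. M). P (\<lambda>k\<in>I. z (i k))"
proof -
  have "AE z in PiM (i ` I) (\<lambda>_. M). P (\<lambda>k\<in>I. z (i k))"
    using assms by (intro AE_PiM_reindex_bij) (auto simp: bij_betw_def)
  from AE_PiM_restrict[OF assms(2,4) this] show ?thesis
    by (simp cong: restrict_cong)
qed

lemma AE_PiM_component:
  assumes "finite J" "k \<in> J" "AE x in M. P x"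
  shows "AE z in PiM J (\<lambda>_. M). P (z k)"
proof -
  obtain A where A: "A \<in> null_sets M" "{x \<in> space M. \<not> P x} \<subseteq> A"
    using assms(3) unfolding eventually_ae_filter by auto
  let ?A = "\<lambda>j. if j = k then A else space M"
  have "emeasure (PiM J (\<lambda>_. M)) (Pi\<^sub>E J ?A) = (\<Prod>j\<in>J. emeasure M (?A j))"
    using A assms by (intro pow.emeasure_PiM) auto
  also have "\<dots> = 0"
    using A assms by (intro prod_zero) auto
  finally have "Pi\<^sub>E J ?A \<in> null_sets (PiM J (\<lambda>_. M))"
    using A assms by (intro null_setsI sets_PiM_I_finite) auto
  then show ?thesis
    by (rule AE_I') (use A assms in \<open>auto simp: space_PiM PiE_iff extensional_def\<close>)
qed

lemma emeasure_PiM_space_neq_0: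
  assumes "finite I" "emeasure M (space M) \<noteq> 0"
  shows "emeasure (PiM I (\<lambda>_. M)) (space (PiM I (\<lambda>_. M))) \<noteq> 0"
  using assms by (simp add: space_PiM pow.emeasure_PiM)

text \<open>By Fubini, almost every \<open>y\<close> has the property; since the space has nonzero
  measure, almost every implies at least one.\<close>

lemma AE_PiM_section:
  assumes "finite I" "finite J" "I \<inter> J = {}" "emeasure M (space M) \<noteq> 0"
    and "AE z in PiM (J \<union> I) (\<lambda>_. M). P z"
  shows "\<exists>y\<in>space (PiM J (\<lambda>_. M)). AE x in PiM I (\<lambda>_. M). P (merge J I (y, x))"
proof -
  interpret I: sigma_finite_measure "PiM I (\<lambda>_. M)" by (rule pow.sigma_finite) fact
  interpret J: sigma_finite_measure "PiM J (\<lambda>_. M)" by (rule pow.sigma_finite) fact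
  interpret P: pair_sigma_finite "PiM J (\<lambda>_. M)" "PiM I (\<lambda>_. M)" ..
  have "AE z in distr (PiM J (\<lambda>_. M) \<Otimes>\<^sub>M PiM I (\<lambda>_. M)) (PiM (J \<union> I) (\<lambda>_. M)) (merge J I). P z"
    using assms by (subst pow.distr_merge) auto
  then have "AE w in PiM J (\<lambda>_. M) \<Otimes>\<^sub>M PiM I (\<lambda>_. M). P (merge J I w)"
    by (rule AE_distrD[OF measurable_merge])
  from P.AE_pair[OF this]
  have ae: "AE y in PiM J (\<lambda>_. M). AE x in PiM I (\<lambda>_. M). P (merge J I (y, x))" .
  show ?thesis
  proof (rule ccontr)
    assume "\<not> ?thesis"
    then have "AE y in PiM J (\<lambda>_. M). \<not> (AE x in PiM I (\<lambda>_. M). P (merge J I (y, x)))"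
      by (intro AE_I2) auto
    with ae have "AE y in PiM J (\<lambda>_. M). False" by eventually_elim auto
    then show False
      using emeasure_PiM_space_neq_0[OF assms(2,4)] by (simp add: eventually_False ae_filter_eq_bot_iff)
  qed
qed

end

text \<open>Measurability of the coordinate map for the product sigma-algebras is not enough between
  completions: null sets must also pull back to null sets, which \<open>AE_PiM_reindex\<close>
  supplies.\<close>

lemma measurable_completion_reindex:
  fixes u :: "(nat \<Rightarrow> 'a) \<Rightarrow> ereal"
  assumes "sigma_finite_measure M" "i \<in> incr_maps m N"
    and u: "u \<in> borel_measurable (pow_measure M m)"
  shows "(\<lambda>x. u (\<lambda>k\<in>{..<m}. x (i k))) \<in> borel_measurable (pow_measure M N)"
proof -
  interpret sigma_finite_measure M by fact
  let ?r = "\<lambda>x. \<lambda>k\<in>{..<m}. x (i k)"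
  note i = incr_maps_inj_on[OF assms(2)] incr_maps_image[OF assms(2)]
  have r: "?r \<in> PiM {..<N} (\<lambda>_. M) \<rightarrow>\<^sub>M PiM {..<m} (\<lambda>_. M)"
    using i by (intro measurable_restrict measurable_component_singleton) auto
  have "?r \<in> completion (PiM {..<N} (\<lambda>_. M)) \<rightarrow>\<^sub>M completion (PiM {..<m} (\<lambda>_. M))"
  proof (rule completion.measurable_completion2)
    show "?r \<in> completion (PiM {..<N} (\<lambda>_. M)) \<rightarrow>\<^sub>M PiM {..<m} (\<lambda>_. M)"
      using r by (rule measurable_completion)
    show "null_sets (PiM {..<m} (\<lambda>_. M)) \<subseteq>
        null_sets (distr (completion (PiM {..<N} (\<lambda>_. M))) (PiM {..<m} (\<lambda>_. M)) ?r)"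
    proof
      fix A assume A: "A \<in> null_sets (PiM {..<m} (\<lambda>_. M))"
      then have "AE x in PiM {..<m} (\<lambda>_. M). x \<notin> A" by (rule AE_not_in)
      from AE_PiM_reindex[OF _ _ i this]
      have "AE x in PiM {..<N} (\<lambda>_. M). ?r x \<notin> A" by simp
      moreover have "?r -` A \<inter> space (PiM {..<N} (\<lambda>_. M)) \<in> sets (PiM {..<N} (\<lambda>_. M))"
        using r A by (auto intro: measurable_sets)
      ultimately have "emeasure (PiM {..<N} (\<lambda>_. M)) (?r -` A \<inter> space (PiM {..<N} (\<lambda>_. M))) = 0"
        by (subst (asm) AE_iff_measurable[OF _ refl]) (auto simp: vimage_def Int_def conj_commute)
      then show "A \<in> null_sets (distr (completion (PiM {..<N} (\<lambda>_. M))) (PiM {..<m} (\<lambda>_. M)) ?r)"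
        using r A by (intro null_setsI) (auto simp: distr_completion emeasure_distr)
    qed
  qed
  from measurable_compose[OF this] u show ?thesis unfolding pow_measure_def .
qed

section \<open>Bounds for generalized means and their kernels\<close>

lemma gen_mean_incr_maps:
  "gen_mean m N u x =
     (\<Sum>i\<in>incr_maps m N. u (\<lambda>k\<in>{..<m}. x (i k))) / ereal (real (N choose m))"
  unfolding gen_mean_def incr_maps_def ..

lemma AE_pow_measure_iff: "(AE x in pow_measure M k. P x) \<longleftrightarrow> (AE x in PiM {..<k} (\<lambda>_. M). P x)"
  unfolding pow_measure_def by (rule AE_completion_iff)

lemma AE_pow_measure_incr_maps:
  assumes "sigma_finite_measure M" "AE x in pow_measure M m. P x"
  shows "AE z in pow_measure M N. \<forall>i\<in>incr_maps m N. P (\<lambda>k\<in>{..<m}. z (i k))"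
proof -
  interpret sigma_finite_measure M by fact
  have "AE z in PiM {..<N} (\<lambda>_. M). P (\<lambda>k\<in>{..<m}. z (i k))" if "i \<in> incr_maps m N" for i
    using assms(2) that incr_maps_inj_on incr_maps_image
    unfolding AE_pow_measure_iff by (intro AE_PiM_reindex) auto
  then show ?thesis
    unfolding AE_pow_measure_iff by (intro AE_finite_allI finite_incr_maps)
qed

text \<open>Where all summands are finite, the extended-real sum is an ordinary real sum, so that
  subtraction and linear combinations are legitimate.\<close>

lemma gen_mean_real:
  assumes "\<And>i. i \<in> incr_maps m N \<Longrightarrow> \<bar>u (\<lambda>k\<in>{..<m}. x (i k))\<bar> \<noteq> \<infinity>" "m \<le> N"
  shows "gen_mean m N u x =
    ereal ((\<Sum>i\<in>incr_maps m N. real_of_ereal (u (\<lambda>k\<in>{..<m}. x (i k)))) / real (N choose m))"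
proof -
  have "(\<Sum>i\<in>incr_maps m N. u (\<lambda>k\<in>{..<m}. x (i k))) =
      (\<Sum>i\<in>incr_maps m N. ereal (real_of_ereal (u (\<lambda>k\<in>{..<m}. x (i k)))))"
    using assms by (intro sum.cong) (auto simp: ereal_real')
  then show ?thesis
    using assms(2) by (simp add: gen_mean_incr_maps)
qed

lemma borel_measurable_gen_mean:
  assumes "sigma_finite_measure M" "u \<in> borel_measurable (pow_measure M m)"
  shows "gen_mean m N u \<in> borel_measurable (pow_measure M N)"
proof -
  have "(\<lambda>x. (\<Sum>i\<in>incr_maps m N. u (\<lambda>k\<in>{..<m}. x (i k))) / ereal (real (N choose m)))
      \<in> borel_measurable (pow_measure M N)"
    by (intro borel_measurable_ereal_divide borel_measurable_ereal_sum borel_measurable_const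
        measurable_completion_reindex assms)
  then show ?thesis by (simp add: gen_mean_incr_maps[abs_def])
qed

lemma gen_mean_Linf:
  assumes M: "sigma_finite_measure M" and "m \<le> N" and u: "u \<in> Linf (pow_measure M m)"
  shows "gen_mean m N u \<in> Linf (pow_measure M N)" (is ?mem)
    and "Linf_norm (pow_measure M N) (gen_mean m N u) \<le> Linf_norm (pow_measure M m) u" (is ?bound)
proof -
  let ?B = "Linf_norm (pow_measure M m) u"
  have [measurable]: "u \<in> borel_measurable (pow_measure M m)" and B: "?B < \<infinity>"
    using u by (auto simp: Linf_def)
  have meas[measurable]: "gen_mean m N u \<in> borel_measurable (pow_measure M N)"
    by (rule borel_measurable_gen_mean) (use M in auto)
  have "AE x in pow_measure M m. \<bar>u x\<bar> \<le> ?B"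
    unfolding Linf_norm_def by (rule esssup_AE)
  from AE_pow_measure_incr_maps[OF M this, of N]
  have "AE z in pow_measure M N. \<bar>gen_mean m N u z\<bar> \<le> ?B"
  proof eventually_elim
    case (elim z)
    let ?r = "\<lambda>i. real_of_ereal (u (\<lambda>k\<in>{..<m}. z (i k)))"
    have pos: "0 < N choose m" using \<open>m \<le> N\<close> by simp
    \<comment> \<open>Nonnegativity of \<open>?B\<close> is read off from one summand at the point
      \<open>z\<close>. Nothing here excludes total measure 0, where \<open>esssup\<close> would be
      \<open>- \<infinity>\<close>.\<close>
    then obtain i where "i \<in> incr_maps m N"
      using card_incr_maps[of m N] by (metis card_gt_0_iff ex_in_conv)
    then have "0 \<le> ?B" using elim order_trans[OF abs_ereal_pos] by blast
    with B obtain b where b: "?B = ereal b" by (cases ?B) auto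
    have fin: "\<bar>u (\<lambda>k\<in>{..<m}. z (i k))\<bar> \<noteq> \<infinity>" "\<bar>?r i\<bar> \<le> b" if "i \<in> incr_maps m N" for i
      using bspec[OF elim that] unfolding b by (cases "u (\<lambda>k\<in>{..<m}. z (i k))"; auto)+
    have "\<bar>\<Sum>i\<in>incr_maps m N. ?r i\<bar> \<le> real (N choose m) * b"
      using order_trans[OF sum_abs sum_bounded_above[of "incr_maps m N" "\<lambda>i. \<bar>?r i\<bar>" b]] fin(2)
      by (simp add: card_incr_maps)
    moreover have "gen_mean m N u z = ereal ((\<Sum>i\<in>incr_maps m N. ?r i) / real (N choose m))"
      using fin(1) \<open>m \<le> N\<close> by (rule gen_mean_real)
    ultimately show ?case
      using pos unfolding b
      by (simp add: abs_divide divide_le_eq mult.commute)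
  qed
  then show ?bound unfolding Linf_norm_def by (intro esssup_I) auto
  then show ?mem using B meas by (auto simp: Linf_def)
qed

text \<open>The coefficients \<open>c\<close> are fixed before \<open>U\<close> and
  \<open>u\<close>, so \<open>C\<close> depends on neither. The binomial factor in \<open>C\<close>
  undoes the normalization of the mean.\<close>

lemma mean_kernel_bound:
  assumes M: "sigma_finite_measure M" "emeasure M (space M) \<noteq> 0" and "m \<le> N"
    and c: "\<And>g :: (nat \<Rightarrow> nat) \<Rightarrow> real. g (\<lambda>k\<in>{..<m}. k) =
       (\<Sum>j\<in>incr_maps N (N + m). c j * (\<Sum>i\<in>incr_maps m N. g (\<lambda>k\<in>{..<m}. j (i k))))"
    and U: "U \<in> Linf (pow_measure M N)" and u: "u \<in> mean_kernel M m N U"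
  defines "C \<equiv> (\<Sum>j\<in>incr_maps N (N + m). \<bar>c j\<bar>) * real (N choose m)"
  shows "u \<in> Linf (pow_measure M m)" (is ?mem)
    and "Linf_norm (pow_measure M m) u \<le> ereal C * Linf_norm (pow_measure M N) U" (is ?bound)
proof -
  interpret sigma_finite_measure M by fact
  let ?L = "N + m" and ?B = "Linf_norm (pow_measure M N) U"
  let ?I = "{..<m}" and ?J = "{m..<N + m}"
  have IJ: "?J \<union> ?I = {..<?L}" "?I \<inter> ?J = {}" by auto
  have [measurable]: "U \<in> borel_measurable (pow_measure M N)" and B: "?B < \<infinity>"
    using U by (auto simp: Linf_def)
  have bd: "AE x in pow_measure M N. \<bar>U x\<bar> \<le> ?B"
    unfolding Linf_norm_def by (rule esssup_AE)
  have "0 \<le> ?B"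
  proof (rule ccontr)
    assume "\<not> 0 \<le> ?B"
    then have "\<not> \<bar>U x\<bar> \<le> ?B" for x using order_trans[OF abs_ereal_pos] by blast
    with bd have "AE x in PiM {..<N} (\<lambda>_. M). False" by (simp add: AE_pow_measure_iff)
    then show False
      using emeasure_PiM_space_neq_0[OF _ M(2), of "{..<N}"]
      by (simp add: eventually_False ae_filter_eq_bot_iff)
  qed
  with B obtain b where b: "?B = ereal b" by (cases ?B) auto
  \<comment> \<open>\<open>U\<close> is measurable only for the completion, and individual sections
    of such a function may fail to be measurable. It is therefore replaced by a version
    \<open>V\<close> measurable for the product sigma-algebra itself.\<close>
  have "(\<lambda>x. real_of_ereal (U x)) \<in> borel_measurable (completion (PiM {..<N} (\<lambda>_. M)))"
    unfolding pow_measure_def[symmetric] by simp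
  then obtain V where V[measurable]: "V \<in> borel_measurable (PiM {..<N} (\<lambda>_. M))"
    and "AE x in PiM {..<N} (\<lambda>_. M). real_of_ereal (U x) = V x"
    by (blast dest: completion_ex_borel_measurable_real)
  then have "AE x in pow_measure M N. real_of_ereal (U x) = V x \<and> \<bar>U x\<bar> \<le> ?B \<and> U x = gen_mean m N u x"
    using bd u by (auto simp: AE_pow_measure_iff mean_kernel_def)
  note aeU = AE_pow_measure_incr_maps[OF M(1) this, of ?L]
  have "AE x in pow_measure M m. \<bar>u x\<bar> \<noteq> \<infinity>"
    using u by (simp add: mean_kernel_def ae_finite_def)
  note aeu = AE_pow_measure_incr_maps[OF M(1) this, of ?L]
  \<comment> \<open>The right-hand side of the inversion formula, with the inner sums replaced by
    \<open>N choose m\<close> times values of \<open>V\<close>. It is an explicit measurable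
    function of all \<open>N + m\<close> coordinates.\<close>
  define \<Phi> where
    "\<Phi> z = (\<Sum>j\<in>incr_maps N ?L. c j * real (N choose m) * V (\<lambda>k\<in>{..<N}. z (j k)))" for z
  have \<Phi>[measurable]: "\<Phi> \<in> borel_measurable (PiM {..<?L} (\<lambda>_. M))"
    unfolding \<Phi>_def
  proof (intro borel_measurable_sum borel_measurable_times borel_measurable_const)
    fix j assume "j \<in> incr_maps N ?L"
    then have "(\<lambda>z. \<lambda>k\<in>{..<N}. z (j k)) \<in> PiM {..<?L} (\<lambda>_. M) \<rightarrow>\<^sub>M PiM {..<N} (\<lambda>_. M)"
      using incr_maps_image by (intro measurable_restrict measurable_component_singleton) blast
    from measurable_compose[OF this V]
    show "(\<lambda>z. V (\<lambda>k\<in>{..<N}. z (j k))) \<in> borel_measurable (PiM {..<?L} (\<lambda>_. M))" .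
  qed
  have "AE z in PiM {..<?L} (\<lambda>_. M). u (restrict z {..<m}) = ereal (\<Phi> z) \<and> \<bar>\<Phi> z\<bar> \<le> C * b"
    using aeU aeu unfolding AE_pow_measure_iff
  proof eventually_elim
    case (elim z)
    \<comment> \<open>The point \<open>z\<close> is fixed from here on, and the inversion formula is
      applied to the values of \<open>u\<close> at its subtuples.\<close>
    define g where "g i = real_of_ereal (u (\<lambda>k\<in>{..<m}. z (i k)))" for i
    have V_eq: "real (N choose m) * V (\<lambda>k\<in>{..<N}. z (j k)) =
        (\<Sum>i\<in>incr_maps m N. g (\<lambda>k\<in>{..<m}. j (i k)))" (is ?eq)
      and V_le: "\<bar>V (\<lambda>k\<in>{..<N}. z (j k))\<bar> \<le> b" (is ?le) if j: "j \<in> incr_maps N ?L" for j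
    proof -
      let ?x = "\<lambda>k\<in>{..<N}. z (j k)"
      \<comment> \<open>A subtuple of a subtuple of \<open>z\<close> is again a subtuple of
        \<open>z\<close>; the inner restriction gives the index the form required by
        \<open>incr_maps_comp\<close>.\<close>
      have x: "(\<lambda>k\<in>{..<m}. ?x (i k)) = (\<lambda>k\<in>{..<m}. z ((\<lambda>k\<in>{..<m}. j (i k)) k))"
        if "i \<in> incr_maps m N" for i
        using incr_maps_image[OF that] by (auto simp: restrict_def fun_eq_iff)
      have "gen_mean m N u ?x =
          ereal ((\<Sum>i\<in>incr_maps m N. real_of_ereal (u (\<lambda>k\<in>{..<m}. ?x (i k)))) / real (N choose m))"
      proof (rule gen_mean_real)
        fix i assume i: "i \<in> incr_maps m N"
        show "\<bar>u (\<lambda>k\<in>{..<m}. ?x (i k))\<bar> \<noteq> \<infinity>"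
          unfolding x[OF i] using incr_maps_comp[OF i j] by (rule bspec[OF elim(2)])
      qed fact
      also have "\<dots> = ereal ((\<Sum>i\<in>incr_maps m N. g (\<lambda>k\<in>{..<m}. j (i k))) / real (N choose m))"
        unfolding g_def
        by (intro arg_cong[where f = ereal] arg_cong2[where f = "(/)"] sum.cong refl) (simp only: x)
      finally have U_eq: "U ?x = ereal ((\<Sum>i\<in>incr_maps m N. g (\<lambda>k\<in>{..<m}. j (i k))) / real (N choose m))"
        using bspec[OF elim(1) j] by simp
      have V_U: "V ?x = real_of_ereal (U ?x)" and "\<bar>U ?x\<bar> \<le> ereal b" using bspec[OF elim(1) j] b by auto
      then show ?le by (simp add: U_eq)
      show ?eq using \<open>m \<le> N\<close> by (simp add: V_U U_eq)
    qed
    have "(\<lambda>k\<in>{..<m}. z ((\<lambda>k\<in>{..<m}. k) k)) = restrict z {..<m}" by (auto simp: restrict_def)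
    then have "\<bar>u (restrict z {..<m})\<bar> \<noteq> \<infinity>" "g (\<lambda>k\<in>{..<m}. k) = real_of_ereal (u (restrict z {..<m}))"
      using bspec[OF elim(2) incr_maps_id] by (simp_all add: g_def)
    then have "u (restrict z {..<m}) = ereal (g (\<lambda>k\<in>{..<m}. k))" by (simp add: ereal_real')
    also have "g (\<lambda>k\<in>{..<m}. k) = \<Phi> z"
      unfolding c[of g] \<Phi>_def by (intro sum.cong) (auto simp: V_eq mult.assoc)
    finally have "u (restrict z {..<m}) = ereal (\<Phi> z)" .
    moreover have "\<bar>\<Phi> z\<bar> \<le> (\<Sum>j\<in>incr_maps N ?L. \<bar>c j\<bar> * real (N choose m) * b)"
      unfolding \<Phi>_def
      by (rule order_trans[OF sum_abs], intro sum_mono)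
         (auto simp: abs_mult intro!: mult_left_mono V_le)
    ultimately show ?case by (simp add: C_def sum_distrib_right)
  qed
  then have "AE z in PiM (?J \<union> ?I) (\<lambda>_. M). u (restrict z {..<m}) = ereal (\<Phi> z) \<and> \<bar>\<Phi> z\<bar> \<le> C * b"
    by (simp only: IJ)
  \<comment> \<open>The left-hand side depends only on the first \<open>m\<close> coordinates, so
    freezing the others at one good \<open>y\<close> loses nothing and leaves \<open>u\<close> equal
    almost everywhere to a section of \<open>\<Phi>\<close>.\<close>
  from AE_PiM_section[OF _ _ IJ(2) M(2) this] obtain y where y: "y \<in> space (PiM ?J (\<lambda>_. M))"
    and ae: "AE x in PiM ?I (\<lambda>_. M). u (restrict (merge ?J ?I (y, x)) ?I) = ereal (\<Phi> (merge ?J ?I (y, x)))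
        \<and> \<bar>\<Phi> (merge ?J ?I (y, x))\<bar> \<le> C * b"
    by blast
  have ae': "AE x in PiM ?I (\<lambda>_. M). u x = ereal (\<Phi> (merge ?J ?I (y, x))) \<and> \<bar>u x\<bar> \<le> ereal (C * b)"
    using ae AE_space
  proof eventually_elim
    case (elim x)
    have "restrict (merge ?J ?I (y, x)) ?I = x"
      using elim(2) IJ by (auto simp: space_PiM PiE_iff merge_def restrict_def extensional_def fun_eq_iff)
    with elim(1) show ?case by auto
  qed
  have "(\<lambda>x. merge ?J ?I (y, x)) \<in> PiM ?I (\<lambda>_. M) \<rightarrow>\<^sub>M PiM {..<?L} (\<lambda>_. M)"
    using measurable_compose[OF measurable_Pair1'[OF y] measurable_merge[of ?J ?I]] unfolding IJ .
  from measurable_compose[OF this \<Phi>]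
  have "(\<lambda>x. ereal (\<Phi> (merge ?J ?I (y, x)))) \<in> borel_measurable (completion (PiM ?I (\<lambda>_. M)))"
    by (intro borel_measurable_ereal measurable_completion)
  moreover have "AE x in completion (PiM ?I (\<lambda>_. M)). u x = ereal (\<Phi> (merge ?J ?I (y, x)))"
    using ae' by (simp add: AE_completion_iff)
  \<comment> \<open>Measurability has to precede the norm estimate, since \<open>esssup\<close> of a
    nonmeasurable function is \<open>\<infinity>\<close> by definition.\<close>
  ultimately have meas[measurable]: "u \<in> borel_measurable (pow_measure M m)"
    unfolding pow_measure_def by (rule completion.borel_measurable_AE_eq)
  have "AE x in pow_measure M m. \<bar>u x\<bar> \<le> ereal (C * b)"
    using ae' by (auto simp: AE_pow_measure_iff)
  then have le: "Linf_norm (pow_measure M m) u \<le> ereal (C * b)"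
    unfolding Linf_norm_def by (intro esssup_I) auto
  then show ?bound by (simp add: b)
  show ?mem using meas order.strict_trans1[OF le, of \<infinity>] by (auto simp: Linf_def)
qed

section \<open>Essential bounds for means of order one\<close>

lemma ereal_le_MInfty_iff: "x \<le> - \<infinity> \<longleftrightarrow> (\<forall>n::nat. x \<le> ereal (- real n))"
proof
  assume *: "\<forall>n::nat. x \<le> ereal (- real n)"
  show "x \<le> - \<infinity>"
  proof (cases x)
    case (real r)
    obtain n where "- r < real n" using reals_Archimedean2 by blast
    with *[rule_format, of n] real show ?thesis by simp
  qed (use *[rule_format, of 0] in auto)
qed auto

lemma gen_mean_1: "gen_mean 1 N (\<lambda>y. u (y 0)) x = (\<Sum>k<N. u (x k)) / ereal (real N)"
proof -
  have "(\<Sum>i\<in>incr_maps 1 N. u (x (i 0))) = (\<Sum>k<N. u (x k))"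
    by (rule sum.reindex_bij_witness[of _ "\<lambda>k. \<lambda>_\<in>{..<1}. k" "\<lambda>i. i 0"])
       (auto simp: incr_maps_def strict_mono_on_def PiE_iff extensional_def fun_eq_iff)
  then show ?thesis by (simp add: gen_mean_incr_maps)
qed

context sigma_finite_measure
begin

lemma AE_mean_le_real_iff:
  fixes u :: "'a \<Rightarrow> ereal"
  assumes [measurable]: "u \<in> borel_measurable M" and fin: "AE x in M. \<bar>u x\<bar> \<noteq> \<infinity>" and "0 < N"
  shows "(AE x in PiM {..<N} (\<lambda>_. M). (\<Sum>k<N. u (x k)) / ereal (real N) \<le> ereal c) \<longleftrightarrow>
    (AE x in M. u x \<le> ereal c)" (is "?l \<longleftrightarrow> ?r")
proof -
  have coord: "AE x in PiM {..<N} (\<lambda>_. M). \<forall>k\<in>{..<N}. P (x k)" if "AE x in M. P x" for P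
    by (intro AE_finite_allI AE_PiM_component that) auto
  have mean: "(\<Sum>k<N. u (x k)) / ereal (real N) = ereal ((\<Sum>k<N. real_of_ereal (u (x k))) / real N)"
    if "\<forall>k\<in>{..<N}. \<bar>u (x k)\<bar> \<noteq> \<infinity>" for x
  proof -
    have "(\<Sum>k<N. u (x k)) = (\<Sum>k<N. ereal (real_of_ereal (u (x k))))"
      using that by (intro sum.cong) (auto simp: ereal_real')
    then show ?thesis using \<open>0 < N\<close> by simp
  qed
  show ?thesis
  proof
    assume ?r
    from coord[OF this] coord[OF fin] show ?l
    proof eventually_elim
      case (elim x)
      have "real_of_ereal (u (x k)) \<le> c" if "k \<in> {..<N}" for k
        using bspec[OF elim(1) that] bspec[OF elim(2) that] by (cases "u (x k)") auto
      then have "(\<Sum>k<N. real_of_ereal (u (x k))) \<le> real N * c"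
        using sum_bounded_above[of "{..<N}" "\<lambda>k. real_of_ereal (u (x k))" c] by simp
      then show ?case using \<open>0 < N\<close> by (simp add: mean[OF elim(2)] divide_le_eq mult.commute)
    qed
  next
    assume ?l
    show ?r
    proof (rule ccontr)
      assume nr: "\<not> ?r"
      \<comment> \<open>The measure of the \<open>N\<close>-th power of \<open>?A\<close> is a
        finite product of nonzero factors, while the mean exceeds \<open>c\<close> at almost every
        point of that power.\<close>
      let ?A = "{x \<in> space M. \<not> u x \<le> ereal c}"
      have A: "?A \<in> sets M" by measurable
      then have "emeasure M ?A \<noteq> 0" using nr by (simp add: AE_iff_measurable[OF _ refl])
      then have "emeasure (PiM {..<N} (\<lambda>_. M)) (Pi\<^sub>E {..<N} (\<lambda>_. ?A)) \<noteq> 0"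
        using A by (subst pow.emeasure_PiM) auto
      moreover have "AE x in PiM {..<N} (\<lambda>_. M). x \<notin> Pi\<^sub>E {..<N} (\<lambda>_. ?A)"
        using coord[OF fin] \<open>?l\<close>
      proof eventually_elim
        case (elim x)
        show ?case
        proof
          assume x: "x \<in> Pi\<^sub>E {..<N} (\<lambda>_. ?A)"
          have "c < real_of_ereal (u (x k))" if "k \<in> {..<N}" for k
            using PiE_mem[OF x that] bspec[OF elim(1) that] by (cases "u (x k)") auto
          then have "(\<Sum>k<N. c) < (\<Sum>k<N. real_of_ereal (u (x k)))"
            using \<open>0 < N\<close> by (intro sum_strict_mono) auto
          then show False
            using elim(2) \<open>0 < N\<close> by (simp add: mean[OF elim(1)] divide_le_eq mult.commute)
        qed
      qed
      ultimately show False
        using A by (simp add: AE_iff_null_sets[symmetric] sets_PiM_I_finite null_sets_def)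
    qed
  qed
qed

lemma AE_mean_le_iff:
  fixes u :: "'a \<Rightarrow> ereal"
  assumes "u \<in> borel_measurable M" "AE x in M. \<bar>u x\<bar> \<noteq> \<infinity>" "0 < N"
  shows "(AE x in PiM {..<N} (\<lambda>_. M). (\<Sum>k<N. u (x k)) / ereal (real N) \<le> z) \<longleftrightarrow>
    (AE x in M. u x \<le> z)"
proof (cases z)
  case (real r)
  then show ?thesis using AE_mean_le_real_iff[OF assms] by simp
next
  \<comment> \<open>The threshold \<open>- \<infinity>\<close> is the conjunction of countably many
    real thresholds, and almost-everywhere statements commute with countable conjunctions.\<close>
  case MInf
  then show ?thesis
    using AE_mean_le_real_iff[OF assms]
    by (simp only: ereal_le_MInfty_iff AE_all_countable)
qed simp

text \<open>The upper-bound version applied to \<open>- u\<close>. Negation passes through an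
  extended-real sum only when \<open>\<infinity> - \<infinity>\<close> is excluded, hence the detour
  through points where all values are finite.\<close>

lemma AE_mean_ge_iff:
  fixes u :: "'a \<Rightarrow> ereal"
  assumes "u \<in> borel_measurable M" "AE x in M. \<bar>u x\<bar> \<noteq> \<infinity>" "0 < N"
  shows "(AE x in PiM {..<N} (\<lambda>_. M). z \<le> (\<Sum>k<N. u (x k)) / ereal (real N)) \<longleftrightarrow>
    (AE x in M. z \<le> u x)"
proof -
  have "AE x in PiM {..<N} (\<lambda>_. M). \<forall>k\<in>{..<N}. \<bar>u (x k)\<bar> \<noteq> \<infinity>"
    by (intro AE_finite_allI AE_PiM_component assms) auto
  then have "AE x in PiM {..<N} (\<lambda>_. M).
      (\<Sum>k<N. - u (x k)) / ereal (real N) = - ((\<Sum>k<N. u (x k)) / ereal (real N))"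
  proof eventually_elim
    case (elim x)
    define r where "r k = real_of_ereal (u (x k))" for k
    have "u (x k) = ereal (r k)" if "k < N" for k
      using elim that by (simp add: r_def ereal_real')
    then have "(\<Sum>k<N. u (x k)) = (\<Sum>k<N. ereal (r k))"
      and "(\<Sum>k<N. - u (x k)) = (\<Sum>k<N. ereal (- r k))"
      by (auto intro!: sum.cong)
    then show ?case using \<open>0 < N\<close> by (simp add: sum_negf)
  qed
  then have "(AE x in PiM {..<N} (\<lambda>_. M). z \<le> (\<Sum>k<N. u (x k)) / ereal (real N)) \<longleftrightarrow>
      (AE x in PiM {..<N} (\<lambda>_. M). (\<Sum>k<N. - u (x k)) / ereal (real N) \<le> - z)"
    by (intro eventually_subst) (auto elim!: eventually_mono)
  also have "\<dots> \<longleftrightarrow> (AE x in M. - u x \<le> - z)"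
    using assms by (intro AE_mean_le_iff) auto
  finally show ?thesis by simp
qed

end

lemma gen_mean_1_bounds:
  fixes u :: "'a \<Rightarrow> ereal"
  assumes M: "sigma_finite_measure M" and "1 \<le> N"
    and u: "u \<in> borel_measurable M" and fin: "ae_finite M u"
  defines "U \<equiv> gen_mean 1 N (\<lambda>y. u (y 0))"
  shows "ess_bdd_above (pow_measure M N) U \<longleftrightarrow> ess_bdd_above M u"
    and "ess_bdd_below (pow_measure M N) U \<longleftrightarrow> ess_bdd_below M u"
    and "esssup (pow_measure M N) U = esssup M u"
    and "essinf (pow_measure M N) U = essinf M u"
    and "U \<in> Linf (pow_measure M N) \<longleftrightarrow> u \<in> Linf M"
    and "Linf_norm (pow_measure M N) U = Linf_norm M u"
proof -
  interpret sigma_finite_measure M by fact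
  have N: "0 < N" using \<open>1 \<le> N\<close> by simp
  have fin': "AE x in M. \<bar>u x\<bar> \<noteq> \<infinity>" using fin by (simp add: ae_finite_def)
  have U: "U = (\<lambda>x. (\<Sum>k<N. u (x k)) / ereal (real N))"
    unfolding U_def by (rule ext) (rule gen_mean_1)
  have "U \<in> borel_measurable (PiM {..<N} (\<lambda>_. M))"
    unfolding U using u
    by (intro borel_measurable_ereal_divide borel_measurable_ereal_sum borel_measurable_const
        measurable_compose[OF measurable_component_singleton]) auto
  then have meas: "U \<in> borel_measurable (pow_measure M N)"
    unfolding pow_measure_def by (rule measurable_completion)
  \<comment> \<open>Essential supremum, infimum and norm are determined by which thresholds hold
    almost everywhere. Once these agree for \<open>U\<close> and \<open>u\<close>, infinite
    thresholds included, all claims follow.\<close>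
  have le: "(AE x in pow_measure M N. U x \<le> z) \<longleftrightarrow> (AE x in M. u x \<le> z)" for z
    unfolding AE_pow_measure_iff U by (rule AE_mean_le_iff[OF u fin' N])
  have ge: "(AE x in pow_measure M N. z \<le> U x) \<longleftrightarrow> (AE x in M. z \<le> u x)" for z
    unfolding AE_pow_measure_iff U by (rule AE_mean_ge_iff[OF u fin' N])
  have abs: "\<bar>x\<bar> \<le> z \<longleftrightarrow> x \<le> z \<and> - z \<le> x" for x z :: ereal
    by (cases x; cases z) auto
  have abs_le: "(AE x in pow_measure M N. \<bar>U x\<bar> \<le> z) \<longleftrightarrow> (AE x in M. \<bar>u x\<bar> \<le> z)" for z
    unfolding abs by (simp add: le ge)
  show "ess_bdd_above (pow_measure M N) U \<longleftrightarrow> ess_bdd_above M u"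
    by (simp add: ess_bdd_above_def le)
  show "ess_bdd_below (pow_measure M N) U \<longleftrightarrow> ess_bdd_below M u"
    by (simp add: ess_bdd_below_def ge)
  show "esssup (pow_measure M N) U = esssup M u"
    using meas u by (simp add: esssup_eq_AE le)
  show "essinf (pow_measure M N) U = essinf M u"
    by (simp add: essinf_def ge)
  show norm: "Linf_norm (pow_measure M N) U = Linf_norm M u"
    using meas u by (simp add: Linf_norm_def esssup_eq_AE abs_le)
  show "U \<in> Linf (pow_measure M N) \<longleftrightarrow> u \<in> Linf M"
    using meas u norm by (simp add: Linf_def)
qed

theorem theorem6:
  fixes M :: "'a measure"
  assumes "sigma_finite_measure M" and "complete_measure M" and "0 < emeasure M (space M)"
  shows
    "(\<forall>N\<ge>1. \<forall>u :: 'a \<Rightarrow> ereal. u \<in> borel_measurable M \<longrightarrow> ae_finite M u \<longrightarrow>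
        (let U = gen_mean 1 N (\<lambda>y. u (y 0)) in
           (ess_bdd_above (pow_measure M N) U \<longleftrightarrow> ess_bdd_above M u) \<and>
           (ess_bdd_below (pow_measure M N) U \<longleftrightarrow> ess_bdd_below M u) \<and>
           esssup (pow_measure M N) U = esssup M u \<and>
           essinf (pow_measure M N) U = essinf M u \<and>
           (u \<in> Linf M \<longleftrightarrow> U \<in> Linf (pow_measure M N)) \<and>
           (u \<in> Linf M \<longrightarrow> Linf_norm (pow_measure M N) U = Linf_norm M u)))
     \<and>
     (\<forall>m N. 1 \<le> m \<longrightarrow> m \<le> N \<longrightarrow>
        (\<forall>u \<in> Linf (pow_measure M m).
           gen_mean m N u \<in> Linf (pow_measure M N) \<and>
           Linf_norm (pow_measure M N) (gen_mean m N u) \<le> Linf_norm (pow_measure M m) u))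
     \<and>
     (\<exists>C :: nat \<Rightarrow> nat \<Rightarrow> real. \<forall>m N. 1 \<le> m \<longrightarrow> m \<le> N \<longrightarrow>
        (\<forall>U \<in> Linf (pow_measure M N). is_gen_mean M m N U \<longrightarrow>
           mean_kernel M m N U \<subseteq> Linf (pow_measure M m) \<and>
           (\<forall>u \<in> mean_kernel M m N U.
              Linf_norm (pow_measure M m) u \<le> ereal (C m N) * Linf_norm (pow_measure M N) U)))"
proof (intro conjI)
  have nonzero: "emeasure M (space M) \<noteq> 0" using assms(3) by simp
  \<comment> \<open>The condition \<open>m \<le> N\<close> stands inside the existential, so that a
    constant exists for every pair and choice yields a total function \<open>C\<close>.\<close>
  have "\<exists>C :: real. m \<le> N \<longrightarrow> (\<forall>U \<in> Linf (pow_measure M N). \<forall>u \<in> mean_kernel M m N U.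
      u \<in> Linf (pow_measure M m) \<and>
      Linf_norm (pow_measure M m) u \<le> ereal C * Linf_norm (pow_measure M N) U)" for m N
  proof (cases "m \<le> N")
    case True
    then obtain c :: "(nat \<Rightarrow> nat) \<Rightarrow> real" where
      "\<And>g :: (nat \<Rightarrow> nat) \<Rightarrow> real. g (\<lambda>k\<in>{..<m}. k) =
         (\<Sum>j\<in>incr_maps N (N + m). c j * (\<Sum>i\<in>incr_maps m N. g (\<lambda>k\<in>{..<m}. j (i k))))"
      using incr_maps_sum_inversion by blast
    from mean_kernel_bound[OF assms(1) nonzero True this] show ?thesis by blast
  qed simp
  then obtain C :: "nat \<Rightarrow> nat \<Rightarrow> real" where
    "\<And>m N U u. m \<le> N \<Longrightarrow> U \<in> Linf (pow_measure M N) \<Longrightarrow> u \<in> mean_kernel M m N U \<Longrightarrow>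
      u \<in> Linf (pow_measure M m) \<and>
      Linf_norm (pow_measure M m) u \<le> ereal (C m N) * Linf_norm (pow_measure M N) U"
    by metis
  then show "\<exists>C :: nat \<Rightarrow> nat \<Rightarrow> real. \<forall>m N. 1 \<le> m \<longrightarrow> m \<le> N \<longrightarrow>
        (\<forall>U \<in> Linf (pow_measure M N). is_gen_mean M m N U \<longrightarrow>
           mean_kernel M m N U \<subseteq> Linf (pow_measure M m) \<and>
           (\<forall>u \<in> mean_kernel M m N U.
              Linf_norm (pow_measure M m) u \<le> ereal (C m N) * Linf_norm (pow_measure M N) U))"
    by (intro exI[of _ C]) blast
qed (use gen_mean_1_bounds[OF assms(1)] gen_mean_Linf[OF assms(1)] in \<open>auto simp: Let_def\<close>)

end
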